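(* Let $\alpha,\beta$ be real numbers, let $n$ be a nonnegative integer, and let $f(x)=x^{-\alpha}\ln^\beta x$ for $x>1$. Then for all $x>1$ the $n$-th derivative of $f$ is $$f^{(n)}(x)=x^{-\alpha-n}\sum_{i=0}^{n}s(n,i,\alpha)\,(\beta)_i\,\ln^{\beta-i}x,$$ where the $s(n,i,\alpha)$ ($0\le i\le n$), the non-central Stirling numbers of the first kind, are polynomials in $\alpha$ with integer coefficients.
   Context: Here $\ln^{\gamma}x=(\ln x)^{\gamma}$. For a real number $\beta$ and a nonnegative integer $i$, $(\beta)_i=\beta(\beta-1)\cdots(\beta-i+1)$ is the falling factorial, with $(\beta)_0=1$. The non-central Stirling numbers of the first kind $s(n,i,\alpha)$ ($0\le i\le n$, $\alpha\in\mathbb R$) are given by $s(0,0,\alpha)=1$ and, for every integer $n\ge 0$, $$s(n+1,0,\alpha)=(-\alpha-n)\,s(n,0,\alpha),$$ $$s(n+1,i,\alpha)=(-\alpha-n)\,s(n,i,\alpha)+s(n,i-1,\alpha)\quad(i=1,\ldots,n),$$ $$s(n+1,n+1,\alpha)=s(n,n,\alpha).$$ *)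

theory Defs
  imports "HOL-Analysis.Analysis" "HOL-Computational_Algebra.Polynomial"
begin

definition falling_fact :: "real \<Rightarrow> nat \<Rightarrow> real" where
  "falling_fact \<beta> i = (\<Prod>j<i. \<beta> - real j)"

text \<open>Non-central Stirling numbers of the first kind, extended by \<open>0\<close> to \<open>i > n\<close>; the
  extension merges the recurrences for \<open>1 \<le> i \<le> n\<close> and for \<open>i = n + 1\<close> into one equation.\<close>

fun nc_stirling1 :: "nat \<Rightarrow> nat \<Rightarrow> real \<Rightarrow> real" where
  "nc_stirling1 0 0 \<alpha> = 1"
| "nc_stirling1 0 (Suc i) \<alpha> = 0"
| "nc_stirling1 (Suc n) 0 \<alpha> = (- \<alpha> - real n) * nc_stirling1 n 0 \<alpha>"
| "nc_stirling1 (Suc n) (Suc i) \<alpha> =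
     (- \<alpha> - real n) * nc_stirling1 n (Suc i) \<alpha> + nc_stirling1 n i \<alpha>"

lemma nc_stirling1_eq_0: "n < i \<Longrightarrow> nc_stirling1 n i \<alpha> = 0"
  by (induction n i \<alpha> rule: nc_stirling1.induct) auto

lemma nc_stirling1_rec:
  assumes "1 \<le> i" "i \<le> n"
  shows "nc_stirling1 (n + 1) i \<alpha> =
    (- \<alpha> - real n) * nc_stirling1 n i \<alpha> + nc_stirling1 n (i - 1) \<alpha>"
  using assms by (cases i) auto

lemma nc_stirling1_diag: "nc_stirling1 (n + 1) (n + 1) \<alpha> = nc_stirling1 n n \<alpha>"
  by (simp add: nc_stirling1_eq_0)

end

theory Submission
  imports Defs
begin

text \<open>Since x^a ln^b x has derivative x^(a-1) (a ln^b x + b ln^(b-1) x), differentiating the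
  i-th term of the formula for n, where a = -\<alpha>-n and b = \<beta>-i, feeds two terms of the
  formula for n+1: index i with factor -\<alpha>-n, and index i+1 with factor \<beta>-i, which turns
  the falling factorial of length i into that of length i+1. What remains is exactly the recurrence
  of the Stirling numbers (\<open>nc_stirling1_sum_Suc\<close>), so each formula is the derivative
  of the previous one (\<open>has_field_derivative_powr_ln_deriv\<close>), and induction on n
  (\<open>higher_deriv_eqI\<close>) concludes. Integrality of the coefficients follows from the same
  recurrence, whose factor -\<alpha>-n is an integer polynomial in \<alpha>.\<close>

lemma falling_fact_0 [simp]: "falling_fact \<beta> 0 = 1"
  by (simp add: falling_fact_def)

lemma falling_fact_Suc: "falling_fact \<beta> (Suc i) = falling_fact \<beta> i * (\<beta> - real i)"
  by (simp add: falling_fact_def)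

lemma map_poly_of_int_add:
  "map_poly (of_int :: int \<Rightarrow> 'a::comm_ring_1) (p + q) = map_poly of_int p + map_poly of_int q"
  by (rule poly_eqI) (simp add: coeff_map_poly)

lemma map_poly_of_int_mult:
  "map_poly (of_int :: int \<Rightarrow> 'a::comm_ring_1) (p * q) = map_poly of_int p * map_poly of_int q"
  by (rule poly_eqI) (simp add: coeff_map_poly coeff_mult)

lemma nc_stirling1_int_poly:
  "\<exists>p :: int poly. \<forall>a. nc_stirling1 n i a = poly (map_poly of_int p) a"
proof (induction n arbitrary: i)
  case 0
  show ?case
  proof (cases i)
    case 0
    then show ?thesis by (intro exI[of _ 1]) simp
  next
    case (Suc j)
    then show ?thesis by (intro exI[of _ 0]) simp
  qed
next
  case (Suc n)
  obtain p :: "int poly" where p: "\<And>a. nc_stirling1 n i a = poly (map_poly of_int p) a"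
    using Suc.IH by blast
  \<comment> \<open>The factor of the recurrence as a linear integer polynomial in the variable
    \<open>a\<close>.\<close>
  have factor: "poly (map_poly of_int [:- int n, -1:]) a = - a - real n" for a :: real
    by (simp add: map_poly_pCons)
  show ?case
  proof (cases i)
    case 0
    with p factor show ?thesis
      by (intro exI[of _ "[:- int n, -1:] * p"])
        (simp only: nc_stirling1.simps map_poly_of_int_mult poly_mult, simp)
  next
    case (Suc j)
    obtain q :: "int poly" where "\<And>a. nc_stirling1 n j a = poly (map_poly of_int q) a"
      using Suc.IH by blast
    with Suc p factor show ?thesis
      by (intro exI[of _ "[:- int n, -1:] * p + q"])
        (simp only: nc_stirling1.simps map_poly_of_int_mult map_poly_of_int_add
          poly_mult poly_add, simp)
  qed
qed

text \<open>The recurrence in summed form, with arbitrary weights \<open>c\<close>: the right-hand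
  side is the shape that term-by-term differentiation produces.\<close>

lemma nc_stirling1_sum_Suc:
  "(\<Sum>i\<le>Suc n. nc_stirling1 (Suc n) i \<alpha> * c i) =
   (\<Sum>i\<le>n. nc_stirling1 n i \<alpha> * ((- \<alpha> - real n) * c i + c (Suc i)))"
proof -
  \<comment> \<open>The added term vanishes by the zero extension to i > n; peeling off i = 0
    afterwards leaves a sum over \<open>Suc i\<close> with the same range i \<le> n as the sum of
    the \<open>c (Suc i)\<close>.\<close>
  have "(\<Sum>i\<le>n. nc_stirling1 n i \<alpha> * c i) = (\<Sum>i\<le>Suc n. nc_stirling1 n i \<alpha> * c i)"
    by (simp add: nc_stirling1_eq_0)
  also have "\<dots> = nc_stirling1 n 0 \<alpha> * c 0 + (\<Sum>i\<le>n. nc_stirling1 n (Suc i) \<alpha> * c (Suc i))"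
    by (rule sum.atMost_Suc_shift)
  finally have shift: "(\<Sum>i\<le>n. nc_stirling1 n i \<alpha> * c i) = \<dots>" .
  have "(\<Sum>i\<le>n. nc_stirling1 n i \<alpha> * ((- \<alpha> - real n) * c i + c (Suc i))) =
      (- \<alpha> - real n) * (\<Sum>i\<le>n. nc_stirling1 n i \<alpha> * c i)
      + (\<Sum>i\<le>n. nc_stirling1 n i \<alpha> * c (Suc i))"
    by (simp only: sum_distrib_left sum.distrib [symmetric]) (simp add: algebra_simps)
  also have "\<dots> = (\<Sum>i\<le>Suc n. nc_stirling1 (Suc n) i \<alpha> * c i)"
    \<comment> \<open>Both sides are now split at index 0, so the two recursive equations of
      \<open>nc_stirling1\<close> apply, one to the head and one to the tail.\<close>
    unfolding shift sum.atMost_Suc_shift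
    by (simp only: nc_stirling1.simps distrib_left distrib_right sum.distrib sum_distrib_left)
      (simp add: algebra_simps)
  finally show ?thesis by simp
qed

text \<open>Product and chain rule; x > 1 makes both bases, x and ln x, positive, as the power rule
  for real exponents requires.\<close>

lemma has_field_derivative_powr_mult_ln_powr:
  fixes a b x :: real
  assumes "x > 1"
  shows "((\<lambda>x. x powr a * ln x powr b) has_field_derivative
    x powr (a - 1) * (a * ln x powr b + b * ln x powr (b - 1))) (at x)"
  using assms by (auto intro!: derivative_eq_intros simp: powr_diff field_simps)

text \<open>The claimed n-th derivative, bracketed so that the falling factorial and the power of
  the logarithm together form the weight \<open>c i\<close> of
  \<open>nc_stirling1_sum_Suc\<close>.\<close>

definition powr_ln_deriv :: "real \<Rightarrow> real \<Rightarrow> nat \<Rightarrow> real \<Rightarrow> real" where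
  "powr_ln_deriv \<alpha> \<beta> n x = x powr (- \<alpha> - real n) *
     (\<Sum>i\<le>n. nc_stirling1 n i \<alpha> * (falling_fact \<beta> i * ln x powr (\<beta> - real i)))"

lemma has_field_derivative_powr_ln_deriv:
  assumes "x > 1"
  shows "(powr_ln_deriv \<alpha> \<beta> n has_field_derivative powr_ln_deriv \<alpha> \<beta> (Suc n) x) (at x)"
proof -
  let ?a = "- \<alpha> - real n"
  define c where "c i = falling_fact \<beta> i * ln x powr (\<beta> - real i)" for i
  have "((\<lambda>x. \<Sum>i\<le>n. nc_stirling1 n i \<alpha> * falling_fact \<beta> i *
        (x powr ?a * ln x powr (\<beta> - real i)))
      has_field_derivative
      (\<Sum>i\<le>n. nc_stirling1 n i \<alpha> * falling_fact \<beta> i *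
        (x powr (?a - 1) * (?a * ln x powr (\<beta> - real i)
          + (\<beta> - real i) * ln x powr (\<beta> - real i - 1))))) (at x)"
    by (intro DERIV_sum DERIV_cmult has_field_derivative_powr_mult_ln_powr assms)
  also have "(\<lambda>x. \<Sum>i\<le>n. nc_stirling1 n i \<alpha> * falling_fact \<beta> i *
      (x powr ?a * ln x powr (\<beta> - real i))) = powr_ln_deriv \<alpha> \<beta> n"
    by (simp add: fun_eq_iff powr_ln_deriv_def sum_distrib_left mult_ac)
  also have "(\<Sum>i\<le>n. nc_stirling1 n i \<alpha> * falling_fact \<beta> i *
        (x powr (?a - 1) * (?a * ln x powr (\<beta> - real i)
          + (\<beta> - real i) * ln x powr (\<beta> - real i - 1)))) =
      x powr (?a - 1) * (\<Sum>i\<le>n. nc_stirling1 n i \<alpha> * (?a * c i + c (Suc i)))"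
    \<comment> \<open>The factor \<beta>-i from the power rule is absorbed by
      \<open>falling_fact_Suc\<close>, giving \<open>c (Suc i)\<close>.\<close>
    unfolding sum_distrib_left
    by (intro sum.cong refl) (simp add: c_def falling_fact_Suc algebra_simps)
  also have "\<dots> = powr_ln_deriv \<alpha> \<beta> (Suc n) x"
    unfolding nc_stirling1_sum_Suc [of n \<alpha> c, symmetric] powr_ln_deriv_def
    by (simp only: c_def of_nat_Suc diff_diff_eq add.commute)
  finally show ?thesis .
qed

text \<open>Derivatives are local, so agreement on an open set passes from each order to the next.
  The first conclusion is stated separately because \<open>deriv\<close> is total: an equation for
  its value does not show that a derivative exists.\<close>

lemma higher_deriv_eqI:
  fixes g :: "nat \<Rightarrow> 'a \<Rightarrow> 'a::real_normed_field"
  assumes "open S" and eq: "\<And>x. x \<in> S \<Longrightarrow> f x = g 0 x"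
    and deriv: "\<And>n x. x \<in> S \<Longrightarrow> (g n has_field_derivative g (Suc n) x) (at x)"
    and "x \<in> S"
  shows "((deriv ^^ n) f has_field_derivative g (Suc n) x) (at x)" "(deriv ^^ n) f x = g n x"
proof -
  have step: "(h has_field_derivative g (Suc n) x) (at x)"
    if "\<And>x. x \<in> S \<Longrightarrow> h x = g n x" "x \<in> S" for h n x
    using has_field_derivative_transform_within_open [OF deriv \<open>open S\<close>] that by metis
  \<comment> \<open>The induction must carry equality on all of \<open>S\<close>, since equality at
    one point says nothing about derivatives.\<close>
  have values_eq: "\<forall>x\<in>S. (deriv ^^ n) f x = g n x" for n
    by (induction n) (auto simp: eq intro!: DERIV_imp_deriv step)
  show "((deriv ^^ n) f has_field_derivative g (Suc n) x) (at x)"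
    using step values_eq \<open>x \<in> S\<close> by blast
  show "(deriv ^^ n) f x = g n x"
    using values_eq \<open>x \<in> S\<close> by blast
qed

theorem theorem1:
  fixes \<alpha> \<beta> :: real and n :: nat and f :: "real \<Rightarrow> real"
  assumes "\<And>x. x > 1 \<Longrightarrow> f x = x powr (- \<alpha>) * (ln x) powr \<beta>"
  shows "(\<forall>x>1. (\<forall>k<n. (deriv ^^ k) f field_differentiable (at x)) \<and>
            (deriv ^^ n) f x =
              x powr (- \<alpha> - real n) *
                (\<Sum>i=0..n. nc_stirling1 n i \<alpha> * falling_fact \<beta> i * (ln x) powr (\<beta> - real i)))
       \<and> (\<forall>i\<le>n. \<exists>p :: int poly. \<forall>a :: real. nc_stirling1 n i a = poly (map_poly of_int p) a)"
proof -
  \<comment> \<open>Order 0: the sum has the single term i = 0, with both coefficients equal to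
    1.\<close>
  have "f x = powr_ln_deriv \<alpha> \<beta> 0 x" if "x \<in> {1<..}" for x
    using that assms by (simp add: powr_ln_deriv_def)
  note derivs = higher_deriv_eqI [where g = "powr_ln_deriv \<alpha> \<beta>", OF open_greaterThan this]
  have "(deriv ^^ k) f field_differentiable (at x)" if "x > 1" for k x
    unfolding field_differentiable_def
    using derivs(1) has_field_derivative_powr_ln_deriv that by fastforce
  moreover have "(deriv ^^ n) f x = powr_ln_deriv \<alpha> \<beta> n x" if "x > 1" for x
    using derivs(2) has_field_derivative_powr_ln_deriv that by fastforce
  ultimately show ?thesis
    using nc_stirling1_int_poly by (simp add: powr_ln_deriv_def atLeast0AtMost mult.assoc)
qed

end
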